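(* Suppose there exist $\overline a,\underline a\in\mathbb{R}_{>0}$ such that $\overline\alpha(s)\le\overline a s$ and $\underline\alpha(s)\ge\underline a s$ for all $s\ge0$. Let $\theta\in\Theta$, $\gamma\in[\gamma_\star,1]$ and $i\in\mathbb{Z}_{>0}$ be such that $|V_{\gamma,i+1}(z)-V_{\gamma,i}(z)|\le c_{\mathrm{stop}}(z,\theta,\gamma,i)$ for all $z\in\mathbb{R}^{n_x}$. Then for any $x\in\mathbb{R}^{n_x}$, $$|V_{\gamma,i+1}(x)-V_{\gamma,\star}(x)|\le\max\big(S_{i+1}(x,\gamma,i),S_\star(x,\gamma,i)\big),$$ where $$S_{i+1}(x,\gamma,i):=\inf_{\phi_{\gamma,i+1}}\sum_{j=0}^\infty\gamma^jc_{\mathrm{stop}}(\phi_{\gamma,i+1}(j;x),\theta,\gamma,i),\qquad S_\star(x,\gamma,i):=\inf_{\phi_{\gamma,\star}}\sum_{j=0}^\infty\gamma^jc_{\mathrm{stop}}(\phi_{\gamma,\star}(j;x),\theta,\gamma,i),$$ the infima (with values in $[0,\infty]$) being over all solutions initialized at $x$ of $x(k+1)\in f(x(k),H_{\gamma,i+1}(x(k)))$ and of $x(k+1)\in f(x(k),H_{\gamma,\star}(x(k)))$, respectively, defined on $\mathbb{Z}_{\ge0}$.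
   Context: Let $n_x,n_u\in\mathbb{Z}_{>0}$, $f:\mathbb{R}^{n_x}\times\mathbb{R}^{n_u}\to\mathbb{R}^{n_x}$, $\mathcal{U}:\mathbb{R}^{n_x}\rightrightarrows\mathbb{R}^{n_u}$ a set-valued map (admissible inputs), $\mathcal{W}:=\{(x,u):u\in\mathcal{U}(x)\}$, $\ell:\mathbb{R}^{n_x}\times\mathbb{R}^{n_u}\to\mathbb{R}_{\ge 0}$ a stage cost. For $x\in\mathbb{R}^{n_x}$ and a sequence $\mathbf{u}=(u_0,u_1,\dots)$, $\phi(k;x,\mathbf{u}|_k)$ is the state at time $k$ of $x(k+1)=f(x(k),u_k)$, $x(0)=x$; $\mathbf{u}$ is admissible from $x$ if $u_k\in\mathcal{U}(\phi(k;x,\mathbf{u}|_k))$ for all $k\in\mathbb{Z}_{\ge0}$. For $\gamma\in(0,1]$, $V_{\gamma,\star}(x):=\inf_{\mathbf{u}}\sum_{k=0}^\infty\gamma^k\ell(\phi(k;x,\mathbf{u}|_k),u_k)$ over admissible $\mathbf{u}$, and $H_{\gamma,\star}(x):=\operatorname{argmin}_{u\in\mathcal{U}(x)}(\ell(x,u)+\gamma V_{\gamma,\star}(f(x,u)))$. Given $V_{\gamma,0}:\mathbb{R}^{n_x}\to\mathbb{R}_{\ge0}$, value iteration defines for $i\in\mathbb{Z}_{>0}$, $V_{\gamma,i}(x):=\inf_{u\in\mathcal{U}(x)}(\ell(x,u)+\gamma V_{\gamma,i-1}(f(x,u)))$ and $H_{\gamma,i}(x):=\operatorname{argmin}_{u\in\mathcal{U}(x)}(\ell(x,u)+\gamma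 V_{\gamma,i-1}(f(x,u)))$. Here $f(x,S)=\{f(x,u):u\in S\}$. $\sigma:\mathbb{R}^{n_x}\to\mathbb{R}_{\ge0}$ is a given continuous, surjective function. Class $\mathcal{K}_\infty$: continuous, strictly increasing, unbounded functions $\mathbb{R}_{\ge0}\to\mathbb{R}_{\ge0}$ vanishing at $0$. Standing assumptions. (1) $f$ is continuous; each $\mathcal{U}(x)$ is non-empty and closed; $\ell$ is lower semicontinuous and there is $\alpha_\ell\in\mathcal{K}_\infty$ with $\ell(x,u)\ge\alpha_\ell(|u|)$ for all $(x,u)$; $V_{\gamma,0}$ is lower semicontinuous. (2) There exists $\underline\alpha\in\mathcal{K}_\infty$ with $\ell(x,u)\ge\underline\alpha(\sigma(x))$ for all $(x,u)\in\mathcal{W}$. (3) There exists $\overline\alpha\in\mathcal{K}_\infty$ with $V_{\gamma,i}(x)\le\overline\alpha(\sigma(x))$ and $V_{\gamma,\star}(x)\le\overline\alpha(\sigma(x))$ for all $i\in\mathbb{Z}_{\ge0}$, $\gamma\in(0,1]$, $x\in\mathbb{R}^{n_x}$. (4) There exist $\gamma_\star\in(0,1]$ and $\alpha\in\mathcal{K}_\infty$ with $\alpha(s)+(1-\gamma_\star)\overline\alpha(s)\le\underline\alpha(s)$ for all $s\ge0$. The stopping criterion function is $c_{\mathrm{stop}}:\mathbb{R}^{n_x}\times\Theta\times(0,1]\times\mathbb{Z}_{\ge0}\to\mathbb{R}_{\ge0}$, with $\Theta\subset\mathbb{R}^{n_\theta}$. *)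

theory Defs
  imports "HOL-Analysis.Analysis"
begin

text \<open>Functions on the nonnegative reals are represented by functions on all of
  \<^typ>\<open>real\<close>; only their restriction to \<open>{0..}\<close> is constrained or used.\<close>

definition class_K_inf :: "(real \<Rightarrow> real) \<Rightarrow> bool" where
  "class_K_inf \<alpha> \<longleftrightarrow>
     continuous_on {0..} \<alpha> \<and> strict_mono_on {0..} \<alpha> \<and> \<alpha> 0 = 0 \<and> \<not> bdd_above (\<alpha> ` {0..})"

definition lower_semicontinuous :: "('a::topological_space \<Rightarrow> real) \<Rightarrow> bool" where
  "lower_semicontinuous g \<longleftrightarrow> (\<forall>x. \<forall>a < g x. \<forall>\<^sub>F y in nhds x. a < g y)"

definition argmin_set :: "'b set \<Rightarrow> ('b \<Rightarrow> 'c::order) \<Rightarrow> 'b set" where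
  "argmin_set S g = {u. is_arg_min g (\<lambda>v. v \<in> S) u}"

primrec state :: "('x \<Rightarrow> 'u \<Rightarrow> 'x) \<Rightarrow> 'x \<Rightarrow> (nat \<Rightarrow> 'u) \<Rightarrow> nat \<Rightarrow> 'x" where
  "state f x u 0 = x"
| "state f x u (Suc k) = f (state f x u k) (u k)"

definition admissible :: "('x \<Rightarrow> 'u \<Rightarrow> 'x) \<Rightarrow> ('x \<Rightarrow> 'u set) \<Rightarrow> 'x \<Rightarrow> (nat \<Rightarrow> 'u) set" where
  "admissible f U x = {u. \<forall>k. u k \<in> U (state f x u k)}"

text \<open>The stage cost is assumed nonnegative wherever these notions are used, so the embedding
  \<^const>\<open>ennreal\<close> does not truncate; the value \<open>\<infinity>\<close> is attained if every
  admissible cost diverges.\<close>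

definition V_star ::
  "('x \<Rightarrow> 'u \<Rightarrow> 'x) \<Rightarrow> ('x \<Rightarrow> 'u set) \<Rightarrow> ('x \<Rightarrow> 'u \<Rightarrow> real) \<Rightarrow> real \<Rightarrow> 'x \<Rightarrow> ennreal" where
  "V_star f U l \<gamma> x =
     (INF u \<in> admissible f U x. \<Sum>k. ennreal (\<gamma> ^ k * l (state f x u k) (u k)))"

definition H_star ::
  "('x \<Rightarrow> 'u \<Rightarrow> 'x) \<Rightarrow> ('x \<Rightarrow> 'u set) \<Rightarrow> ('x \<Rightarrow> 'u \<Rightarrow> real) \<Rightarrow> real \<Rightarrow> 'x \<Rightarrow> 'u set" where
  "H_star f U l \<gamma> x =
     argmin_set (U x) (\<lambda>u. ennreal (l x u) + ennreal \<gamma> * V_star f U l \<gamma> (f x u))"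

text \<open>Here \<open>V0\<close> is the initial function for the given discount factor. The real infimum
  is the mathematical one because the costs are nonnegative and the sets \<open>U x\<close>
  nonempty.\<close>

primrec V_iter ::
  "('x \<Rightarrow> 'u \<Rightarrow> 'x) \<Rightarrow> ('x \<Rightarrow> 'u set) \<Rightarrow> ('x \<Rightarrow> 'u \<Rightarrow> real) \<Rightarrow> real \<Rightarrow> ('x \<Rightarrow> real) \<Rightarrow>
    nat \<Rightarrow> 'x \<Rightarrow> real" where
  "V_iter f U l \<gamma> V0 0 = V0"
| "V_iter f U l \<gamma> V0 (Suc i) = (\<lambda>x. INF u \<in> U x. l x u + \<gamma> * V_iter f U l \<gamma> V0 i (f x u))"

text \<open>Only meaningful for \<open>i > 0\<close>.\<close>

definition H_iter ::
  "('x \<Rightarrow> 'u \<Rightarrow> 'x) \<Rightarrow> ('x \<Rightarrow> 'u set) \<Rightarrow> ('x \<Rightarrow> 'u \<Rightarrow> real) \<Rightarrow> real \<Rightarrow> ('x \<Rightarrow> real) \<Rightarrow>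
    nat \<Rightarrow> 'x \<Rightarrow> 'u set" where
  "H_iter f U l \<gamma> V0 i x =
     argmin_set (U x) (\<lambda>u. l x u + \<gamma> * V_iter f U l \<gamma> V0 (i - 1) (f x u))"

definition solutions :: "('x \<Rightarrow> 'u \<Rightarrow> 'x) \<Rightarrow> ('x \<Rightarrow> 'u set) \<Rightarrow> 'x \<Rightarrow> (nat \<Rightarrow> 'x) set" where
  "solutions f H x = {\<phi>. \<phi> 0 = x \<and> (\<forall>k. \<phi> (Suc k) \<in> f (\<phi> k) ` H (\<phi> k))}"

text \<open>If there is no solution from \<open>x\<close> defined for all times, the infimum is \<open>\<infinity>\<close>.\<close>

definition S_bound ::
  "(nat \<Rightarrow> 'x) set \<Rightarrow> ('x \<Rightarrow> 'p \<Rightarrow> real \<Rightarrow> nat \<Rightarrow> real) \<Rightarrow> 'p \<Rightarrow> real \<Rightarrow> nat \<Rightarrow> ennreal" where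
  "S_bound sols c \<theta> \<gamma> i = (INF \<phi> \<in> sols. \<Sum>j. ennreal (\<gamma> ^ j * c (\<phi> j) \<theta> \<gamma> i))"

end

theory Submission
  imports Defs
begin

text \<open>
  The bound is a telescoping argument along closed-loop trajectories. Write \<open>V'\<close> for the iterate
  \<open>i + 1\<close>, \<open>V\<close> for the iterate \<open>i\<close>, \<open>W\<close> for the optimal value function, and \<open>c\<close> for the stopping
  threshold. Of two functions to be compared, one satisfies its Bellman equation with equality
  along a trajectory generated by its own minimizers, while the other satisfies the same relation
  with \<open>\<le>\<close>, because the inputs along the trajectory are merely feasible for it. Subtracting cancels
  the stage cost, and replacing \<open>V\<close> by \<open>V'\<close> at the next state costs at most \<open>c\<close>. So the gap \<open>D\<close>
  between the two functions obeys \<open>D j \<le> \<gamma> * (D (j + 1) + c (j + 1))\<close>, where \<open>D = V' - W\<close> along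
  trajectories of \<open>H_star\<close> and \<open>D = W - V'\<close> along trajectories of \<open>H_iter\<close>.

  Unrolling leaves the remainder \<open>\<gamma>^N * D N\<close>, and everything hinges on this tending to zero. The
  linear bounds on the comparison functions make both \<open>V'\<close> and \<open>W\<close> at most a constant
  multiple of the stage cost of any admissible input, so it suffices that the discounted stage
  costs are summable along the trajectory. Along \<open>H_star\<close> they add up to at most
  the optimal value. Along \<open>H_iter\<close> the Bellman recursion passes from \<open>V'\<close> to \<open>V\<close> at every step, and
  the resulting defects add up to at most the discounted sum of \<open>c\<close>; if this sum diverges,
  the estimate for this trajectory is trivial. Lemma \<open>discounted_gap_le\<close> carries this argument out for real sequences.

  Every trajectory obeys the estimate, so passing to the infimum is immediate, also when
  minimizers do not exist and the set of trajectories is empty.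
\<close>

section \<open>Telescoping discounted inequalities\<close>

text \<open>The energy balance of a trajectory: the storage \<open>A\<close> is nonnegative and pays for the running
  cost \<open>L\<close> up to the supply \<open>c\<close>, so the total discounted cost is bounded by the initial storage plus
  the total discounted supply.\<close>

lemma summable_discounted_cost:
  fixes A L c :: "nat \<Rightarrow> real"
  assumes "0 < \<gamma>" and A: "\<And>j. 0 \<le> A j" and L: "\<And>j. 0 \<le> L j" and c: "\<And>j. 0 \<le> c j"
    and step: "\<And>j. L j + \<gamma> * A (Suc j) \<le> A j + \<gamma> * c (Suc j)"
    and c_summable: "summable (\<lambda>j. \<gamma> ^ j * c j)"
  shows "summable (\<lambda>j. \<gamma> ^ j * L j)"
proof (rule summableI_nonneg_bounded)
  fix N
  \<comment> \<open>The supply enters with a delay of one step, so after \<open>N\<close> steps \<open>c N\<close> has been used; the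
    surplus term \<open>c 0\<close> makes the right-hand side a partial sum of the whole series.\<close>
  have "(\<Sum>j<N. \<gamma> ^ j * L j) + \<gamma> ^ N * A N \<le> A 0 + (\<Sum>j<Suc N. \<gamma> ^ j * c j)"
  proof (induction N)
    case 0
    then show ?case using c[of 0] by simp
  next
    case (Suc N)
    have "\<gamma> ^ N * (L N + \<gamma> * A (Suc N)) \<le> \<gamma> ^ N * (A N + \<gamma> * c (Suc N))"
      using step \<open>0 < \<gamma>\<close> by (intro mult_left_mono) auto
    with Suc show ?case by (simp add: algebra_simps)
  qed
  moreover have "(\<Sum>j<Suc N. \<gamma> ^ j * c j) \<le> (\<Sum>j. \<gamma> ^ j * c j)"
    using \<open>0 < \<gamma>\<close> c by (intro sum_le_suminf c_summable) auto
  moreover have "0 \<le> \<gamma> ^ N * A N"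
    using \<open>0 < \<gamma>\<close> A by simp
  ultimately show "(\<Sum>j<N. \<gamma> ^ j * L j) \<le> A 0 + (\<Sum>j. \<gamma> ^ j * c j)"
    by linarith
qed (use \<open>0 < \<gamma>\<close> L in auto)

text \<open>Here \<open>A\<close> is the function whose minimizers generate the trajectory, \<open>B\<close> the one compared with
  it. The bound \<open>dom\<close> is what kills the remainder: \<open>\<gamma>^N * (B N - A N) \<le> K * \<gamma>^N * L N\<close> is dominated
  by the terms of a convergent series.\<close>

lemma discounted_gap_le:
  fixes A B L c :: "nat \<Rightarrow> real"
  assumes "0 < \<gamma>" and A: "\<And>j. 0 \<le> A j" and L: "\<And>j. 0 \<le> L j" and c: "\<And>j. 0 \<le> c j"
    and balance: "\<And>j. L j + \<gamma> * A (Suc j) \<le> A j + \<gamma> * c (Suc j)"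
    and gap: "\<And>j. B j - A j \<le> \<gamma> * (B (Suc j) - A (Suc j) + c (Suc j))"
    and dom: "\<And>j. B j \<le> K * L j"
  shows "ennreal (B 0 - A 0) \<le> (\<Sum>j. ennreal (\<gamma> ^ j * c j))"
proof (cases "(\<Sum>j. ennreal (\<gamma> ^ j * c j)) = top")
  case False
  have c_nonneg: "0 \<le> \<gamma> ^ j * c j" for j
    using \<open>0 < \<gamma>\<close> c by simp
  have c_summable: "summable (\<lambda>j. \<gamma> ^ j * c j)"
    using summable_suminf_not_top[OF c_nonneg False] .
  have "summable (\<lambda>j. \<gamma> ^ j * L j)"
    by (rule summable_discounted_cost[OF \<open>0 < \<gamma>\<close> A L c balance c_summable])
  then have "(\<lambda>N. K * (\<gamma> ^ N * L N)) \<longlonglongrightarrow> K * 0"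
    by (intro tendsto_mult_left summable_LIMSEQ_zero)
  then have lim: "(\<lambda>N. (\<Sum>j. \<gamma> ^ j * c j) + K * (\<gamma> ^ N * L N)) \<longlonglongrightarrow> (\<Sum>j. \<gamma> ^ j * c j) + K * 0"
    by (intro tendsto_add tendsto_const)
  have "B 0 - A 0 \<le> (\<Sum>j. \<gamma> ^ j * c j) + K * (\<gamma> ^ N * L N)" for N
  proof -
    have "B 0 - A 0 \<le> (\<Sum>j<Suc N. \<gamma> ^ j * c j) + \<gamma> ^ N * (B N - A N)"
    proof (induction N)
      case 0
      then show ?case using c[of 0] by simp
    next
      case (Suc N)
      have "\<gamma> ^ N * (B N - A N) \<le> \<gamma> ^ N * (\<gamma> * (B (Suc N) - A (Suc N) + c (Suc N)))"
        using gap \<open>0 < \<gamma>\<close> by (intro mult_left_mono) auto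
      with Suc show ?case by (simp add: algebra_simps)
    qed
    also have "\<dots> \<le> (\<Sum>j. \<gamma> ^ j * c j) + \<gamma> ^ N * (K * L N)"
    proof (intro add_mono mult_left_mono)
      show "(\<Sum>j<Suc N. \<gamma> ^ j * c j) \<le> (\<Sum>j. \<gamma> ^ j * c j)"
        using c_nonneg by (intro sum_le_suminf c_summable) auto
      show "B N - A N \<le> K * L N"
        using A[of N] dom[of N] by linarith
    qed (use \<open>0 < \<gamma>\<close> in simp)
    finally show ?thesis by (simp add: algebra_simps)
  qed
  then have "B 0 - A 0 \<le> (\<Sum>j. \<gamma> ^ j * c j)"
    using LIMSEQ_le_const[OF lim] by auto
  then show ?thesis
    by (simp add: suminf_ennreal2[OF c_nonneg c_summable] ennreal_leI)
qed simp

section \<open>The Bellman relations\<close>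

lemma argmin_set_iff:
  fixes g :: "'b \<Rightarrow> 'c::linorder"
  shows "u \<in> argmin_set S g \<longleftrightarrow> u \<in> S \<and> (\<forall>v\<in>S. g u \<le> g v)"
  by (auto simp: argmin_set_def is_arg_min_linorder)

text \<open>Deterministic optimal control problems with a nonnegative stage cost and at least one
  admissible input in every state.\<close>

locale control_problem =
  fixes f :: "'x \<Rightarrow> 'u \<Rightarrow> 'x" and U :: "'x \<Rightarrow> 'u set" and l :: "'x \<Rightarrow> 'u \<Rightarrow> real" and \<gamma> :: real
  assumes l_nonneg: "0 \<le> l z u"
    and U_ne: "U z \<noteq> {}"
    and \<gamma>_pos: "0 < \<gamma>"
begin

definition cost :: "'x \<Rightarrow> (nat \<Rightarrow> 'u) \<Rightarrow> ennreal" where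
  "cost z u = (\<Sum>k. ennreal (\<gamma> ^ k * l (state f z u k) (u k)))"

lemma state_Suc_shift: "state f z u (Suc k) = state f (f z (u 0)) (\<lambda>k. u (Suc k)) k"
  by (induction k) simp_all

lemma admissible_shift_iff:
  "u \<in> admissible f U z \<longleftrightarrow> u 0 \<in> U z \<and> (\<lambda>k. u (Suc k)) \<in> admissible f U (f z (u 0))"
proof -
  have all_nat: "(\<forall>k. P k) \<longleftrightarrow> P 0 \<and> (\<forall>k. P (Suc k))" for P :: "nat \<Rightarrow> bool"
    by (metis not0_implies_Suc)
  show ?thesis
    unfolding admissible_def mem_Collect_eq all_nat[of "\<lambda>k. u k \<in> U (state f z u k)"] state_Suc_shift
    by simp
qed

lemma cost_shift:
  "cost z u = ennreal (l z (u 0)) + ennreal \<gamma> * cost (f z (u 0)) (\<lambda>k. u (Suc k))"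
proof -
  let ?t = "\<lambda>k. ennreal (\<gamma> ^ k * l (state f z u k) (u k))"
  have "(\<lambda>k. ?t (Suc k)) sums (\<Sum>k. ?t (Suc k))"
    by (simp add: summable_sums)
  then have "(\<Sum>k. ?t k) = (\<Sum>k. ?t (Suc k)) + ?t 0"
    by (intro sums_unique[symmetric] sums_Suc)
  also have "(\<Sum>k. ?t (Suc k)) = ennreal \<gamma> * cost (f z (u 0)) (\<lambda>k. u (Suc k))"
    using \<gamma>_pos l_nonneg unfolding cost_def ennreal_suminf_cmult[symmetric] state_Suc_shift
    by (simp add: ennreal_mult[symmetric] mult.assoc)
  finally show ?thesis
    by (simp add: cost_def add.commute)
qed

lemma V_star_eq_INF_cost: "V_star f U l \<gamma> z = (INF u \<in> admissible f U z. cost z u)"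
  by (simp add: V_star_def cost_def)

text \<open>Every admissible continuation from the next state can be prepended with \<open>v\<close>. Solving the
  resulting inequality for the cost of the continuation lets the infimum be taken over it.\<close>

lemma V_star_le_bellman:
  assumes "v \<in> U z"
  shows "V_star f U l \<gamma> z \<le> ennreal (l z v) + ennreal \<gamma> * V_star f U l \<gamma> (f z v)"
proof -
  have "(V_star f U l \<gamma> z - ennreal (l z v)) / ennreal \<gamma> \<le> cost (f z v) u"
    if u: "u \<in> admissible f U (f z v)" for u
  proof -
    have "case_nat v u \<in> admissible f U z"
      using assms u by (subst admissible_shift_iff) simp
    then have "V_star f U l \<gamma> z \<le> cost z (case_nat v u)"
      unfolding V_star_eq_INF_cost by (rule INF_lower)
    also have "\<dots> = ennreal (l z v) + ennreal \<gamma> * cost (f z v) u"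
      by (subst cost_shift) simp
    finally show ?thesis
      using \<gamma>_pos by (simp add: ennreal_minus_le_iff divide_le_posI_ennreal)
  qed
  then have "(V_star f U l \<gamma> z - ennreal (l z v)) / ennreal \<gamma> \<le> V_star f U l \<gamma> (f z v)"
    unfolding V_star_eq_INF_cost[of "f z v"] by (rule INF_greatest)
  then have "ennreal \<gamma> * ((V_star f U l \<gamma> z - ennreal (l z v)) / ennreal \<gamma>)
      \<le> ennreal \<gamma> * V_star f U l \<gamma> (f z v)"
    by (rule mult_left_mono) simp
  then show ?thesis
    using \<gamma>_pos by (simp add: ennreal_times_divide ennreal_mult_divide_eq mult.commute[of "ennreal \<gamma>"]
      ennreal_minus_le_iff)
qed

text \<open>Any admissible sequence costs at least its first stage cost plus the discounted optimal value
  of the state it reaches, and a minimizer makes this quantity smallest.\<close>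

lemma V_star_ge_bellman:
  assumes "v \<in> H_star f U l \<gamma> z"
  shows "ennreal (l z v) + ennreal \<gamma> * V_star f U l \<gamma> (f z v) \<le> V_star f U l \<gamma> z"
  unfolding V_star_eq_INF_cost[of z]
proof (rule INF_greatest)
  fix u assume u: "u \<in> admissible f U z"
  then have "u 0 \<in> U z" and tail: "(\<lambda>k. u (Suc k)) \<in> admissible f U (f z (u 0))"
    using admissible_shift_iff[of u z] by blast+
  then have "ennreal (l z v) + ennreal \<gamma> * V_star f U l \<gamma> (f z v)
      \<le> ennreal (l z (u 0)) + ennreal \<gamma> * V_star f U l \<gamma> (f z (u 0))"
    using assms by (simp add: H_star_def argmin_set_iff)
  also have "\<dots> \<le> cost z u"
    unfolding cost_shift[of z u] V_star_eq_INF_cost[of "f z (u 0)"]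
    by (intro add_left_mono mult_left_mono INF_lower tail) simp
  finally show "ennreal (l z v) + ennreal \<gamma> * V_star f U l \<gamma> (f z v) \<le> cost z u" .
qed

lemma V_iter_nonneg:
  assumes "\<And>z. 0 \<le> V0 z"
  shows "0 \<le> V_iter f U l \<gamma> V0 j z"
proof (induction j arbitrary: z)
  case (Suc j)
  then show ?case
    using \<gamma>_pos l_nonneg U_ne by (auto intro!: cINF_greatest)
qed (use assms in simp)

lemma V_iter_le_bellman:
  assumes "\<And>z. 0 \<le> V0 z" and "v \<in> U z"
  shows "V_iter f U l \<gamma> V0 (Suc j) z \<le> l z v + \<gamma> * V_iter f U l \<gamma> V0 j (f z v)"
proof -
  have "bdd_below ((\<lambda>u. l z u + \<gamma> * V_iter f U l \<gamma> V0 j (f z u)) ` U z)"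
    using \<gamma>_pos l_nonneg V_iter_nonneg[OF assms(1)] by (intro bdd_belowI2[of _ 0]) simp
  then show ?thesis
    unfolding V_iter.simps using assms(2) by (rule cINF_lower)
qed

lemma V_iter_ge_bellman:
  assumes "v \<in> H_iter f U l \<gamma> V0 (Suc j) z"
  shows "l z v + \<gamma> * V_iter f U l \<gamma> V0 j (f z v) \<le> V_iter f U l \<gamma> V0 (Suc j) z"
  using assms U_ne unfolding V_iter.simps
  by (intro cINF_greatest) (simp_all add: H_iter_def argmin_set_iff)

end

section \<open>Comparing value functions along closed-loop trajectories\<close>

lemma solutionsE:
  assumes "\<phi> \<in> solutions f H x"
  obtains u where "\<phi> 0 = x" "\<And>k. u k \<in> H (\<phi> k)" "\<And>k. \<phi> (Suc k) = f (\<phi> k) (u k)"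
proof -
  have "\<forall>k. \<exists>v. v \<in> H (\<phi> k) \<and> \<phi> (Suc k) = f (\<phi> k) v" and "\<phi> 0 = x"
    using assms by (auto simp: solutions_def)
  then show ?thesis
    using that by metis
qed

text \<open>What the comparison needs from the growth bounds is only that one multiple \<open>K\<close> of the stage cost
  dominates both value functions, which makes the telescoping remainders vanish.\<close>

locale value_iteration_stop = control_problem f U l \<gamma>
  for f :: "'x \<Rightarrow> 'u \<Rightarrow> 'x" and U l \<gamma> +
  fixes V0 :: "'x \<Rightarrow> real" and K :: real and i :: nat and c :: "'x \<Rightarrow> real"
  assumes V0_nonneg: "0 \<le> V0 z"
    and V_star_finite: "V_star f U l \<gamma> z < top"
    and V_star_dom: "u \<in> U z \<Longrightarrow> enn2real (V_star f U l \<gamma> z) \<le> K * l z u"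
    and V_iter_dom: "u \<in> U z \<Longrightarrow> V_iter f U l \<gamma> V0 (Suc i) z \<le> K * l z u"
    and stop: "\<bar>V_iter f U l \<gamma> V0 (Suc i) z - V_iter f U l \<gamma> V0 i z\<bar> \<le> c z"
begin

abbreviation "V \<equiv> V_iter f U l \<gamma> V0"
abbreviation "W z \<equiv> enn2real (V_star f U l \<gamma> z)"

lemma c_nonneg: "0 \<le> c z"
  using stop[of z] by linarith

lemma V_star_eq_ennreal_W: "V_star f U l \<gamma> z = ennreal (W z)"
  using V_star_finite by simp

lemma ennreal_bellman:
  "ennreal (l z v) + ennreal \<gamma> * V_star f U l \<gamma> (f z v) = ennreal (l z v + \<gamma> * W (f z v))"
  using l_nonneg \<gamma>_pos by (subst V_star_eq_ennreal_W) (simp add: ennreal_mult)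

lemma W_le_bellman: "v \<in> U z \<Longrightarrow> W z \<le> l z v + \<gamma> * W (f z v)"
  using V_star_le_bellman[of v z] l_nonneg[of z v] \<gamma>_pos
  unfolding ennreal_bellman by (intro enn2real_leI) auto

lemma W_ge_bellman:
  assumes "v \<in> H_star f U l \<gamma> z"
  shows "l z v + \<gamma> * W (f z v) \<le> W z"
proof -
  have "0 \<le> l z v + \<gamma> * W (f z v)"
    using l_nonneg[of z v] \<gamma>_pos by auto
  then show ?thesis
    using enn2real_mono[OF V_star_ge_bellman[OF assms] V_star_finite]
    by (simp only: ennreal_bellman enn2real_ennreal)
qed

lemma V_iter_minus_V_star_le:
  assumes "\<phi> \<in> solutions f (H_star f U l \<gamma>) x"
  shows "ennreal (V (Suc i) x - W x) \<le> (\<Sum>j. ennreal (\<gamma> ^ j * c (\<phi> j)))"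
proof -
  obtain u where \<phi>0: "\<phi> 0 = x" and u: "\<And>k. u k \<in> H_star f U l \<gamma> (\<phi> k)"
    and \<phi>: "\<And>k. \<phi> (Suc k) = f (\<phi> k) (u k)"
    using solutionsE[OF assms] by metis
  have uU: "u k \<in> U (\<phi> k)" for k
    using u[of k] by (simp add: H_star_def argmin_set_iff)
  have balance: "l (\<phi> k) (u k) + \<gamma> * W (\<phi> (Suc k)) \<le> W (\<phi> k)" for k
    using W_ge_bellman[OF u] \<phi> by simp
  have next_le: "\<gamma> * V i z \<le> \<gamma> * (V (Suc i) z + c z)" for z
    using stop[of z] \<gamma>_pos by (intro mult_left_mono) linarith+
  have "ennreal (V (Suc i) (\<phi> 0) - W (\<phi> 0)) \<le> (\<Sum>j. ennreal (\<gamma> ^ j * c (\<phi> j)))"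
  proof (rule discounted_gap_le[OF \<gamma>_pos])
    fix j
    show "V (Suc i) (\<phi> j) \<le> K * l (\<phi> j) (u j)"
      by (rule V_iter_dom[OF uU])
    show "l (\<phi> j) (u j) + \<gamma> * W (\<phi> (Suc j)) \<le> W (\<phi> j) + \<gamma> * c (\<phi> (Suc j))"
      using balance[of j] mult_nonneg_nonneg[OF less_imp_le[OF \<gamma>_pos] c_nonneg[of "\<phi> (Suc j)"]]
      by linarith
    have "V (Suc i) (\<phi> j) \<le> l (\<phi> j) (u j) + \<gamma> * V i (\<phi> (Suc j))"
      using V_iter_le_bellman[OF V0_nonneg uU[of j], where j = i] by (simp only: \<phi>)
    with balance[of j] next_le[of "\<phi> (Suc j)"]
    show "V (Suc i) (\<phi> j) - W (\<phi> j)
        \<le> \<gamma> * (V (Suc i) (\<phi> (Suc j)) - W (\<phi> (Suc j)) + c (\<phi> (Suc j)))"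
      unfolding distrib_left right_diff_distrib by linarith
  qed (auto simp: l_nonneg c_nonneg)
  then show ?thesis by (simp only: \<phi>0)
qed

lemma V_star_minus_V_iter_le:
  assumes "\<phi> \<in> solutions f (H_iter f U l \<gamma> V0 (Suc i)) x"
  shows "ennreal (W x - V (Suc i) x) \<le> (\<Sum>j. ennreal (\<gamma> ^ j * c (\<phi> j)))"
proof -
  obtain u where \<phi>0: "\<phi> 0 = x" and u: "\<And>k. u k \<in> H_iter f U l \<gamma> V0 (Suc i) (\<phi> k)"
    and \<phi>: "\<And>k. \<phi> (Suc k) = f (\<phi> k) (u k)"
    using solutionsE[OF assms] by metis
  have uU: "u k \<in> U (\<phi> k)" for k
    using u[of k] by (simp add: H_iter_def argmin_set_iff)
  have next_le: "\<gamma> * V (Suc i) z \<le> \<gamma> * (V i z + c z)" for z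
    using stop[of z] \<gamma>_pos by (intro mult_left_mono) linarith+
  have balance: "l (\<phi> k) (u k) + \<gamma> * V (Suc i) (\<phi> (Suc k))
      \<le> V (Suc i) (\<phi> k) + \<gamma> * c (\<phi> (Suc k))" for k
    using V_iter_ge_bellman[OF u[of k]] next_le[of "\<phi> (Suc k)"] unfolding \<phi> distrib_left by linarith
  have "ennreal (W (\<phi> 0) - V (Suc i) (\<phi> 0)) \<le> (\<Sum>j. ennreal (\<gamma> ^ j * c (\<phi> j)))"
  proof (rule discounted_gap_le[OF \<gamma>_pos])
    fix j
    show "W (\<phi> j) \<le> K * l (\<phi> j) (u j)"
      by (rule V_star_dom[OF uU])
    show "l (\<phi> j) (u j) + \<gamma> * V (Suc i) (\<phi> (Suc j)) \<le> V (Suc i) (\<phi> j) + \<gamma> * c (\<phi> (Suc j))"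
      by (rule balance)
    have "W (\<phi> j) \<le> l (\<phi> j) (u j) + \<gamma> * W (\<phi> (Suc j))"
      using W_le_bellman[OF uU[of j]] by (simp only: \<phi>)
    with balance[of j]
    show "W (\<phi> j) - V (Suc i) (\<phi> j)
        \<le> \<gamma> * (W (\<phi> (Suc j)) - V (Suc i) (\<phi> (Suc j)) + c (\<phi> (Suc j)))"
      unfolding distrib_left right_diff_distrib by linarith
    show "0 \<le> V (Suc i) (\<phi> j)"
      by (rule V_iter_nonneg[OF V0_nonneg])
  qed (auto simp: l_nonneg c_nonneg)
  then show ?thesis by (simp only: \<phi>0)
qed

end

theorem theorem9:
  fixes f :: "real ^ 'n \<Rightarrow> real ^ 'm \<Rightarrow> real ^ 'n"
    and U :: "real ^ 'n \<Rightarrow> (real ^ 'm) set"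
    and l :: "real ^ 'n \<Rightarrow> real ^ 'm \<Rightarrow> real"
    and V0 :: "real \<Rightarrow> real ^ 'n \<Rightarrow> real"
    and \<sigma> :: "real ^ 'n \<Rightarrow> real"
    and \<alpha>_low \<alpha>_up :: "real \<Rightarrow> real"
    and \<gamma>_star \<gamma> :: real
    and \<Theta> :: "(real ^ 'p) set"
    and c_stop :: "real ^ 'n \<Rightarrow> real ^ 'p \<Rightarrow> real \<Rightarrow> nat \<Rightarrow> real"
    and \<theta> :: "real ^ 'p"
    and i :: nat
    and x :: "real ^ 'n"
  assumes l_nonneg: "\<And>z u. 0 \<le> l z u"
    and V0_nonneg: "\<And>g z. g \<in> {0<..1} \<Longrightarrow> 0 \<le> V0 g z"
    and \<sigma>_cont: "continuous_on UNIV \<sigma>"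
    and \<sigma>_surj: "range \<sigma> = {0..}"
    and f_cont: "continuous_on UNIV (\<lambda>(z, u). f z u)"
    and U_ne: "\<And>z. U z \<noteq> {}"
    and U_closed: "\<And>z. closed (U z)"
    and l_lsc: "lower_semicontinuous (\<lambda>(z, u). l z u)"
    and l_coercive: "\<exists>\<alpha>_l. class_K_inf \<alpha>_l \<and> (\<forall>z u. \<alpha>_l (norm u) \<le> l z u)"
    and V0_lsc: "\<And>g. g \<in> {0<..1} \<Longrightarrow> lower_semicontinuous (V0 g)"
    and \<alpha>_low: "class_K_inf \<alpha>_low"
    and l_lower: "\<And>z u. u \<in> U z \<Longrightarrow> \<alpha>_low (\<sigma> z) \<le> l z u"
    and \<alpha>_up: "class_K_inf \<alpha>_up"
    and V_iter_upper: "\<And>j g z. g \<in> {0<..1} \<Longrightarrow> V_iter f U l g (V0 g) j z \<le> \<alpha>_up (\<sigma> z)"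
    and V_star_upper: "\<And>g z. g \<in> {0<..1} \<Longrightarrow> V_star f U l g z \<le> ennreal (\<alpha>_up (\<sigma> z))"
    and \<gamma>_star: "\<gamma>_star \<in> {0<..1}"
    and detect: "\<exists>\<alpha>. class_K_inf \<alpha> \<and> (\<forall>s\<ge>0. \<alpha> s + (1 - \<gamma>_star) * \<alpha>_up s \<le> \<alpha>_low s)"
    and c_stop_nonneg:
      "\<And>z t g j. t \<in> \<Theta> \<Longrightarrow> g \<in> {0<..1} \<Longrightarrow> 0 \<le> c_stop z t g j"
    and linear_up: "\<exists>a_up>0. \<forall>s\<ge>0. \<alpha>_up s \<le> a_up * s"
    and linear_low: "\<exists>a_low>0. \<forall>s\<ge>0. a_low * s \<le> \<alpha>_low s"
    and \<theta>: "\<theta> \<in> \<Theta>"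
    and \<gamma>: "\<gamma> \<in> {\<gamma>_star..1}"
    and i: "0 < i"
    and stop: "\<And>z. \<bar>V_iter f U l \<gamma> (V0 \<gamma>) (i + 1) z - V_iter f U l \<gamma> (V0 \<gamma>) i z\<bar>
                     \<le> c_stop z \<theta> \<gamma> i"
  shows "ennreal \<bar>V_iter f U l \<gamma> (V0 \<gamma>) (i + 1) x - enn2real (V_star f U l \<gamma> x)\<bar>
    \<le> max (S_bound (solutions f (H_iter f U l \<gamma> (V0 \<gamma>) (i + 1)) x) c_stop \<theta> \<gamma> i)
           (S_bound (solutions f (H_star f U l \<gamma>) x) c_stop \<theta> \<gamma> i)"
proof -
  obtain a_up where a_up: "0 < a_up" "\<And>s. 0 \<le> s \<Longrightarrow> \<alpha>_up s \<le> a_up * s"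
    using linear_up by blast
  obtain a_low where a_low: "0 < a_low" "\<And>s. 0 \<le> s \<Longrightarrow> a_low * s \<le> \<alpha>_low s"
    using linear_low by blast
  have \<gamma>01: "\<gamma> \<in> {0<..1}"
    using \<gamma> \<gamma>_star by auto
  have \<sigma>_nonneg: "0 \<le> \<sigma> z" for z
    using \<sigma>_surj by (metis atLeast_iff rangeI)
  \<comment> \<open>Both value functions are at most \<open>a_up * \<sigma> z\<close>, the stage cost at least \<open>a_low * \<sigma> z\<close>.\<close>
  have dom: "\<alpha>_up (\<sigma> z) \<le> a_up / a_low * l z u" if "u \<in> U z" for z u
  proof -
    have "a_low * \<sigma> z \<le> l z u"
      using a_low(2)[OF \<sigma>_nonneg] l_lower[OF that] by (rule order_trans)
    then have "\<sigma> z \<le> l z u / a_low"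
      using a_low(1) by (simp add: field_simps)
    then have "a_up * \<sigma> z \<le> a_up * (l z u / a_low)"
      using a_up(1) by (intro mult_left_mono) auto
    then show ?thesis
      using a_up(2)[OF \<sigma>_nonneg, of z] by simp
  qed
  have \<alpha>_up_nonneg: "0 \<le> \<alpha>_up (\<sigma> z)" for z
    using V_iter_upper[OF \<gamma>01, of 0 z] V0_nonneg[OF \<gamma>01, of z] by simp
  interpret value_iteration_stop f U l \<gamma> "V0 \<gamma>" "a_up / a_low" i "\<lambda>z. c_stop z \<theta> \<gamma> i"
  proof
    fix z
    show "V_star f U l \<gamma> z < top"
      using V_star_upper[OF \<gamma>01] by (rule le_less_trans) simp
    show "\<bar>V_iter f U l \<gamma> (V0 \<gamma>) (Suc i) z - V_iter f U l \<gamma> (V0 \<gamma>) i z\<bar> \<le> c_stop z \<theta> \<gamma> i"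
      using stop[of z] by simp
    fix u assume u: "u \<in> U z"
    have "enn2real (V_star f U l \<gamma> z) \<le> \<alpha>_up (\<sigma> z)"
      using V_star_upper[OF \<gamma>01] \<alpha>_up_nonneg by (rule enn2real_leI[rotated])
    then show "enn2real (V_star f U l \<gamma> z) \<le> a_up / a_low * l z u"
      using dom[OF u] by (rule order_trans)
    show "V_iter f U l \<gamma> (V0 \<gamma>) (Suc i) z \<le> a_up / a_low * l z u"
      using V_iter_upper[OF \<gamma>01] dom[OF u] by (rule order_trans)
  qed (use l_nonneg U_ne V0_nonneg \<gamma>01 in auto)
  have "ennreal (V (Suc i) x - W x) \<le> S_bound (solutions f (H_star f U l \<gamma>) x) c_stop \<theta> \<gamma> i"
    unfolding S_bound_def by (intro INF_greatest V_iter_minus_V_star_le)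
  moreover have "ennreal (W x - V (Suc i) x)
      \<le> S_bound (solutions f (H_iter f U l \<gamma> (V0 \<gamma>) (Suc i)) x) c_stop \<theta> \<gamma> i"
    unfolding S_bound_def by (intro INF_greatest V_star_minus_V_iter_le)
  ultimately show ?thesis
    unfolding Suc_eq_plus1[symmetric] by (cases "W x \<le> V (Suc i) x") (simp_all add: le_max_iff_disj)
qed

end
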